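(* Let $\mathscr{X}$ be a locally finite thick building with Coxeter matrix $(m_{i,j})_{i,j\in I}$ such that $m_{i,j}<\infty$ for each pair $i,j\in I$. Then $\mathscr{X}$ is regular.
   Context: Let $I$ be a finite set and $(m_{i,j})_{i,j\in I}$ a Coxeter matrix ($m_{i,i}=1$, and $m_{i,j}=m_{j,i}\in\{2,3,\ldots\}\cup\{\infty\}$ for $i\neq j$), with Coxeter group $W=\langle s_i\ (i\in I)\mid (s_is_j)^{m_{i,j}}=1\rangle$ (relation omitted when $m_{i,j}=\infty$), $S=\{s_i\mid i\in I\}$, and length function $\ell$. For a word $f=i_1\cdots i_n$ in $I$ write $s_f=s_{i_1}\cdots s_{i_n}$; $f$ is reduced if $\ell(s_f)=n$. A chamber system over $I$ is a set $\mathcal{C}$ (of chambers) with an equivalence relation $\sim_i$ for each $i\in I$. A gallery of type $i_1\cdots i_n$ is a sequence $c_0,\ldots,c_n$ of chambers with $c_{k-1}\sim_{i_k}c_k$ and $c_{k-1}\neq c_k$ for $1\le k\le n$. A building of type $W$ is a chamber system over $I$ such that (1) for each $c\in\mathcal{C}$ and $i\in I$ there is $d\neq c$ with $d\sim_i c$, and (2) there is a function $\delta:\mathcal{C}\times\mathcal{C}\to W$ such that, for every reduced word $f$, $\delta(c,d)=s_f$ if and only if $c$ and $d$ can be joined by a gallery of type $f$. It is locally finite if $I$ is finite and $\{b\mid a\sim_i b\}$ is finite for all $a\in\mathcal{C}$, $i\in I$. It is thick if for each $c\in\mathcal{C}$ and $i\in I$ there are at least two distinct chambers $d\neq c$ with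 $d\sim_i c$. For $a\in\mathcal{C}$, $w\in W$ put $\mathcal{C}_w(a)=\{b\in\mathcal{C}\mid\delta(a,b)=w\}$. The building is regular if for each $s\in S$ the number $|\mathcal{C}_s(a)|$ does not depend on $a\in\mathcal{C}$. *)

theory Defs
  imports "HOL-Algebra.Group" "HOL-Library.Extended_Nat" "HOL-Library.Equipollence"
begin

section \<open>Groups given by generators and relations\<close>

text \<open>A letter \<open>(x, True)\<close> stands for the generator \<open>x\<close> and \<open>(x, False)\<close> for its formal inverse.\<close>

type_synonym 'x gword = "('x \<times> bool) list"

definition gwords :: "'x set \<Rightarrow> 'x gword set" where
  "gwords X = lists (X \<times> UNIV)"

inductive pres_eq :: "'x set \<Rightarrow> 'x gword set \<Rightarrow> 'x gword \<Rightarrow> 'x gword \<Rightarrow> bool"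
  for X :: "'x set" and R :: "'x gword set" where
  refl: "u \<in> gwords X \<Longrightarrow> pres_eq X R u u"
| sym: "pres_eq X R u v \<Longrightarrow> pres_eq X R v u"
| trans: "pres_eq X R u v \<Longrightarrow> pres_eq X R v w \<Longrightarrow> pres_eq X R u w"
| cancel: "u \<in> gwords X \<Longrightarrow> v \<in> gwords X \<Longrightarrow> x \<in> X
    \<Longrightarrow> pres_eq X R (u @ [(x, e), (x, \<not> e)] @ v) (u @ v)"
| relator: "u \<in> gwords X \<Longrightarrow> v \<in> gwords X \<Longrightarrow> r \<in> R \<Longrightarrow> r \<in> gwords X
    \<Longrightarrow> pres_eq X R (u @ r @ v) (u @ v)"

definition pres_rel :: "'x set \<Rightarrow> 'x gword set \<Rightarrow> 'x gword rel" where
  "pres_rel X R = {(u, v). pres_eq X R u v}"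

definition presented_group :: "'x set \<Rightarrow> 'x gword set \<Rightarrow> 'x gword set monoid" where
  "presented_group X R =
    \<lparr> carrier = gwords X // pres_rel X R,
      mult = (\<lambda>A B. \<Union>u\<in>A. \<Union>v\<in>B. pres_rel X R `` {u @ v}),
      one = pres_rel X R `` {[]} \<rparr>"

lemma append_in_gwords [simp]: "u @ v \<in> gwords X \<longleftrightarrow> u \<in> gwords X \<and> v \<in> gwords X"
  by (auto simp: gwords_def)

lemma Nil_in_gwords [simp]: "[] \<in> gwords X"
  by (auto simp: gwords_def)

lemma pres_eq_gwords: "pres_eq X R u v \<Longrightarrow> u \<in> gwords X \<and> v \<in> gwords X"
  by (induction rule: pres_eq.induct) (auto simp: gwords_def)

lemma pres_eq_context:
  "pres_eq X R u v \<Longrightarrow> p \<in> gwords X \<Longrightarrow> q \<in> gwords X \<Longrightarrow> pres_eq X R (p @ u @ q) (p @ v @ q)"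
proof (induction rule: pres_eq.induct)
  case (cancel u v x e)
  then show ?case using pres_eq.cancel[of "p @ u" X "v @ q" x R e] by simp
next
  case (relator u v r)
  then show ?case using pres_eq.relator[of "p @ u" X "v @ q" r R] by simp
next
  case (trans u v w)
  then show ?case using pres_eq.trans by metis
qed (simp_all add: pres_eq.refl pres_eq.sym)

lemma pres_eq_append:
  assumes "pres_eq X R u u'" "pres_eq X R v v'"
  shows "pres_eq X R (u @ v) (u' @ v')"
  using pres_eq_context[OF assms(1), of "[]" v] pres_eq_context[OF assms(2), of u' "[]"]
    assms[THEN pres_eq_gwords] pres_eq.trans[of X R "u @ v" "u' @ v" "u' @ v'"] by simp

lemma equiv_pres_rel: "equiv (gwords X) (pres_rel X R)"
proof (rule equivI)
  show "pres_rel X R \<subseteq> gwords X \<times> gwords X"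
    using pres_eq_gwords by (fastforce simp: pres_rel_def)
  show "refl_on (gwords X) (pres_rel X R)"
    by (simp add: refl_on_def pres_rel_def pres_eq.refl)
  show "sym (pres_rel X R)"
    by (simp add: sym_def pres_rel_def pres_eq.sym)
  show "trans (pres_rel X R)"
    by (rule transI) (simp add: pres_rel_def, rule pres_eq.trans)
qed

lemma pres_mult_class:
  assumes "u \<in> gwords X" "v \<in> gwords X"
  shows "(pres_rel X R `` {u}) \<otimes>\<^bsub>presented_group X R\<^esub> (pres_rel X R `` {v})
    = pres_rel X R `` {u @ v}"
proof -
  have eq: "pres_rel X R `` {u' @ v'} = pres_rel X R `` {u @ v}"
    if "u' \<in> pres_rel X R `` {u}" "v' \<in> pres_rel X R `` {v}" for u' v'
  proof (rule equiv_class_eq[OF equiv_pres_rel])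
    have "pres_eq X R u u'" "pres_eq X R v v'" using that by (simp_all add: pres_rel_def)
    then have "pres_eq X R (u' @ v') (u @ v)" by (rule pres_eq.sym[OF pres_eq_append])
    then show "(u' @ v', u @ v) \<in> pres_rel X R" by (simp add: pres_rel_def)
  qed
  have "u \<in> pres_rel X R `` {u}" "v \<in> pres_rel X R `` {v}"
    using assms by (simp_all add: pres_rel_def pres_eq.refl)
  then have ne: "pres_rel X R `` {u} \<noteq> {}" "pres_rel X R `` {v} \<noteq> {}"
    by blast+
  have "(\<Union>u'\<in>pres_rel X R `` {u}. \<Union>v'\<in>pres_rel X R `` {v}. pres_rel X R `` {u' @ v'})
    = (\<Union>u'\<in>pres_rel X R `` {u}. \<Union>v'\<in>pres_rel X R `` {v}. pres_rel X R `` {u @ v})"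
    by (intro SUP_cong HOL.refl eq)
  then show ?thesis
    using ne by (simp only: presented_group_def monoid.simps UN_constant if_False)
qed

definition gword_inv :: "'x gword \<Rightarrow> 'x gword" where
  "gword_inv u = rev (map (\<lambda>(x, e). (x, \<not> e)) u)"

lemma gword_inv_in_gwords: "u \<in> gwords X \<Longrightarrow> gword_inv u \<in> gwords X"
  by (auto simp: gwords_def gword_inv_def)

lemma pres_eq_inv: "u \<in> gwords X \<Longrightarrow> pres_eq X R (gword_inv u @ u) []"
proof (induction u)
  case Nil
  then show ?case by (simp add: gword_inv_def pres_eq.refl)
next
  case (Cons a u)
  obtain x e where a: "a = (x, e)" by (cases a)
  have u: "u \<in> gwords X" and x: "x \<in> X" using Cons.prems by (auto simp: gwords_def a)
  have "pres_eq X R (gword_inv u @ [(x, \<not> e), (x, \<not> \<not> e)] @ u) (gword_inv u @ u)"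
    by (rule pres_eq.cancel) (use u x gword_inv_in_gwords in auto)
  then have "pres_eq X R (gword_inv u @ [(x, \<not> e), (x, \<not> \<not> e)] @ u) []"
    using Cons.IH[OF u] by (rule pres_eq.trans)
  then show ?case by (simp add: a gword_inv_def)
qed

lemma group_presented_group: "group (presented_group X R)"
proof (rule groupI)
  let ?G = "presented_group X R" and ?c = "\<lambda>u. pres_rel X R `` {u}"
  have carr: "x \<in> carrier ?G \<longleftrightarrow> (\<exists>u\<in>gwords X. x = ?c u)" for x
    by (auto simp: presented_group_def quotient_def)
  have one: "\<one>\<^bsub>?G\<^esub> = ?c []" by (simp add: presented_group_def)
  have carrI: "?c u \<in> carrier ?G" if "u \<in> gwords X" for u
    using that carr by blast
  show "\<one>\<^bsub>?G\<^esub> \<in> carrier ?G" unfolding one by (rule carrI) simp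
  fix x assume "x \<in> carrier ?G"
  then obtain u where u: "u \<in> gwords X" "x = ?c u" using carr by blast
  show "\<one>\<^bsub>?G\<^esub> \<otimes>\<^bsub>?G\<^esub> x = x" by (simp add: one u pres_mult_class)
  have "?c (gword_inv u) \<otimes>\<^bsub>?G\<^esub> x = ?c (gword_inv u @ u)"
    by (simp add: u pres_mult_class gword_inv_in_gwords)
  also have "\<dots> = \<one>\<^bsub>?G\<^esub>" unfolding one
    by (rule equiv_class_eq[OF equiv_pres_rel]) (simp add: pres_rel_def pres_eq_inv u)
  finally show "\<exists>y\<in>carrier ?G. y \<otimes>\<^bsub>?G\<^esub> x = \<one>\<^bsub>?G\<^esub>"
    by (rule bexI) (rule carrI[OF gword_inv_in_gwords[OF u(1)]])
  fix y assume "y \<in> carrier ?G"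
  then obtain v where v: "v \<in> gwords X" "y = ?c v" using carr by blast
  show "x \<otimes>\<^bsub>?G\<^esub> y \<in> carrier ?G" 
    by (simp add: u v pres_mult_class carrI)
  fix z assume "z \<in> carrier ?G"
  then obtain w where w: "w \<in> gwords X" "z = ?c w" using carr by blast
  show "x \<otimes>\<^bsub>?G\<^esub> y \<otimes>\<^bsub>?G\<^esub> z = x \<otimes>\<^bsub>?G\<^esub> (y \<otimes>\<^bsub>?G\<^esub> z)"
    by (simp add: u v w pres_mult_class)
qed


section \<open>Coxeter groups\<close>

definition coxeter_matrix :: "'i set \<Rightarrow> ('i \<Rightarrow> 'i \<Rightarrow> enat) \<Rightarrow> bool" where
  "coxeter_matrix I m \<longleftrightarrow> finite I \<and> (\<forall>i\<in>I. m i i = 1) \<and>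
    (\<forall>i\<in>I. \<forall>j\<in>I. i \<noteq> j \<longrightarrow> m i j = m j i \<and> 2 \<le> m i j)"

definition coxeter_relators :: "'i set \<Rightarrow> ('i \<Rightarrow> 'i \<Rightarrow> enat) \<Rightarrow> 'i gword set" where
  "coxeter_relators I m =
    {concat (replicate n [(i, True), (j, True)]) | i j n. i \<in> I \<and> j \<in> I \<and> m i j = enat n}"

definition coxeter_group :: "'i set \<Rightarrow> ('i \<Rightarrow> 'i \<Rightarrow> enat) \<Rightarrow> 'i gword set monoid" where
  "coxeter_group I m = presented_group I (coxeter_relators I m)"

definition cox_gen :: "'i set \<Rightarrow> ('i \<Rightarrow> 'i \<Rightarrow> enat) \<Rightarrow> 'i \<Rightarrow> 'i gword set" where
  "cox_gen I m i = pres_rel I (coxeter_relators I m) `` {[(i, True)]}"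

definition cox_gens :: "'i set \<Rightarrow> ('i \<Rightarrow> 'i \<Rightarrow> enat) \<Rightarrow> 'i gword set set" where
  "cox_gens I m = cox_gen I m ` I"

definition cox_word :: "'i set \<Rightarrow> ('i \<Rightarrow> 'i \<Rightarrow> enat) \<Rightarrow> 'i list \<Rightarrow> 'i gword set" where
  "cox_word I m f =
    foldr (\<lambda>i w. cox_gen I m i \<otimes>\<^bsub>coxeter_group I m\<^esub> w) f \<one>\<^bsub>coxeter_group I m\<^esub>"

text \<open>Words in the generators alone suffice to define the length, since \<open>m i i = 1\<close> makes
  every generator its own inverse.\<close>

definition cox_length :: "'i set \<Rightarrow> ('i \<Rightarrow> 'i \<Rightarrow> enat) \<Rightarrow> 'i gword set \<Rightarrow> nat" where
  "cox_length I m w = (LEAST n. \<exists>f\<in>lists I. length f = n \<and> cox_word I m f = w)"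

definition reduced_word :: "'i set \<Rightarrow> ('i \<Rightarrow> 'i \<Rightarrow> enat) \<Rightarrow> 'i list \<Rightarrow> bool" where
  "reduced_word I m f \<longleftrightarrow> f \<in> lists I \<and> cox_length I m (cox_word I m f) = length f"


section \<open>Chamber systems and buildings\<close>

definition chamber_system :: "'i set \<Rightarrow> 'c set \<Rightarrow> ('i \<Rightarrow> 'c rel) \<Rightarrow> bool" where
  "chamber_system I C adj \<longleftrightarrow> (\<forall>i\<in>I. equiv C (adj i))"

definition gallery :: "'c set \<Rightarrow> ('i \<Rightarrow> 'c rel) \<Rightarrow> 'i list \<Rightarrow> 'c list \<Rightarrow> bool" where
  "gallery C adj f cs \<longleftrightarrow> cs \<in> lists C \<and> length cs = Suc (length f) \<and>
    (\<forall>k<length f. (cs ! k, cs ! Suc k) \<in> adj (f ! k) \<and> cs ! k \<noteq> cs ! Suc k)"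

definition joined :: "'c set \<Rightarrow> ('i \<Rightarrow> 'c rel) \<Rightarrow> 'i list \<Rightarrow> 'c \<Rightarrow> 'c \<Rightarrow> bool" where
  "joined C adj f c d \<longleftrightarrow> (\<exists>cs. gallery C adj f cs \<and> hd cs = c \<and> last cs = d)"

definition weyl_distance ::
  "'i set \<Rightarrow> ('i \<Rightarrow> 'i \<Rightarrow> enat) \<Rightarrow> 'c set \<Rightarrow> ('i \<Rightarrow> 'c rel) \<Rightarrow> ('c \<Rightarrow> 'c \<Rightarrow> 'i gword set) \<Rightarrow> bool" where
  "weyl_distance I m C adj \<delta> \<longleftrightarrow>
    (\<forall>c\<in>C. \<forall>d\<in>C. \<delta> c d \<in> carrier (coxeter_group I m)) \<and>
    (\<forall>f. reduced_word I m f \<longrightarrow>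
      (\<forall>c\<in>C. \<forall>d\<in>C. \<delta> c d = cox_word I m f \<longleftrightarrow> joined C adj f c d))"

definition building ::
  "'i set \<Rightarrow> ('i \<Rightarrow> 'i \<Rightarrow> enat) \<Rightarrow> 'c set \<Rightarrow> ('i \<Rightarrow> 'c rel) \<Rightarrow> bool" where
  "building I m C adj \<longleftrightarrow> coxeter_matrix I m \<and> chamber_system I C adj \<and>
    (\<forall>c\<in>C. \<forall>i\<in>I. \<exists>d. d \<noteq> c \<and> (d, c) \<in> adj i) \<and>
    (\<exists>\<delta>. weyl_distance I m C adj \<delta>)"

definition locally_finite :: "'i set \<Rightarrow> 'c set \<Rightarrow> ('i \<Rightarrow> 'c rel) \<Rightarrow> bool" where
  "locally_finite I C adj \<longleftrightarrow> finite I \<and> (\<forall>a\<in>C. \<forall>i\<in>I. finite {b. (a, b) \<in> adj i})"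

definition thick :: "'i set \<Rightarrow> 'c set \<Rightarrow> ('i \<Rightarrow> 'c rel) \<Rightarrow> bool" where
  "thick I C adj \<longleftrightarrow> (\<forall>c\<in>C. \<forall>i\<in>I. \<exists>d d'. d \<noteq> d' \<and> d \<noteq> c \<and> d' \<noteq> c \<and>
    (d, c) \<in> adj i \<and> (d', c) \<in> adj i)"

definition sphere :: "'c set \<Rightarrow> ('c \<Rightarrow> 'c \<Rightarrow> 'w) \<Rightarrow> 'w \<Rightarrow> 'c \<Rightarrow> 'c set" where
  "sphere C \<delta> w a = {b \<in> C. \<delta> a b = w}"

text \<open>Regularity compares cardinalities by \<open>eqpoll\<close> and not by \<open>card\<close>, which would
  identify all infinite cardinalities with \<open>0\<close>. The function \<open>\<delta>\<close> is determined on \<open>C \<times> C\<close> by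
  \<open>weyl_distance\<close>, because every element of the Coxeter group is given by a reduced word.\<close>

definition regular_building ::
  "'i set \<Rightarrow> ('i \<Rightarrow> 'i \<Rightarrow> enat) \<Rightarrow> 'c set \<Rightarrow> ('c \<Rightarrow> 'c \<Rightarrow> 'i gword set) \<Rightarrow> bool" where
  "regular_building I m C \<delta> \<longleftrightarrow>
    (\<forall>s\<in>cox_gens I m. \<forall>a\<in>C. \<forall>b\<in>C. sphere C \<delta> s a \<approx> sphere C \<delta> s b)"

end

theory Submission
  imports Defs
begin

text \<open>
  Panels \<open>P\<close> of type \<open>i\<close> and \<open>Q\<close> of type \<open>k\<close> are in bijection as soon as they contain chambers at
  distance \<open>w\<close> with \<open>s\<^sub>i w = w s\<^sub>k\<close> longer than \<open>w\<close>. In the finite dihedral group generated by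
  \<open>s\<^sub>i\<close> and \<open>s\<^sub>j\<close>, the element \<open>w\<close> just below the longest one, with reduced word starting with \<open>i\<close>,
  satisfies \<open>s\<^sub>j w = w s\<^sub>k\<close> for some \<open>k\<close>. If \<open>a\<close> and \<open>b\<close> are \<open>i\<close>-adjacent, thickness gives a third
  chamber \<open>c\<close> of their \<open>i\<close>-panel, and a chamber at distance \<open>s\<^sub>i w\<close> from \<open>c\<close> is at distance \<open>w\<close> from
  both \<open>a\<close> and \<open>b\<close>; hence the \<open>j\<close>-panels of \<open>a\<close> and \<open>b\<close> have the same size.

  Neither the exchange condition for the presented group nor the exact order of \<open>s\<^sub>i s\<^sub>j\<close> is needed
  beforehand: the required case of the exchange condition is read off from the thick building, as
  for Tits systems, and from the presentation one only uses the parity of the length and that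
  \<open>s\<^sub>i s\<^sub>j\<close> has finite order.
\<close>

section \<open>Words in a Coxeter group\<close>

text \<open>A cancellation removes two letters and a relator an even number, so every generating
  step keeps the parity of the length.\<close>

lemma pres_eq_parity:
  assumes "pres_eq X R u v" and "\<And>r. r \<in> R \<Longrightarrow> even (length r)"
  shows "even (length u) \<longleftrightarrow> even (length v)"
  using assms by (induction rule: pres_eq.induct) auto

fun alt_word :: "'a \<Rightarrow> 'a \<Rightarrow> nat \<Rightarrow> 'a list" where
  "alt_word i j 0 = []"
| "alt_word i j (Suc n) = i # alt_word j i n"

lemma length_alt_word [simp]: "length (alt_word i j n) = n"
  by (induction i j n rule: alt_word.induct) auto

text \<open>The recursion shows the first letter; this shows the last one, whose value depends on
  the parity of the length. Both ends are needed to compare \<open>i # f\<close> with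
  \<open>f @ [k]\<close>.\<close>

lemma alt_word_snoc:
  "alt_word i j (Suc n) = alt_word i j n @ [if even n then i else j]"
  by (induction i j n rule: alt_word.induct) auto

lemma alt_word_in_lists: "i \<in> I \<Longrightarrow> j \<in> I \<Longrightarrow> alt_word i j n \<in> lists I"
  by (induction i j n rule: alt_word.induct) auto

lemma alt_word_double: "alt_word i j (2 * n) = concat (replicate n [i, j])"
  by (induction n) auto

locale coxeter_data =
  fixes I :: "'i set" and m :: "'i \<Rightarrow> 'i \<Rightarrow> enat"
  assumes cm: "coxeter_matrix I m"
begin

abbreviation "weq \<equiv> pres_eq I (coxeter_relators I m)"
abbreviation "pos \<equiv> map (\<lambda>i. (i, True))"
abbreviation "cw \<equiv> cox_word I m"
abbreviation "red \<equiv> reduced_word I m"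

section \<open>Representing group elements by positive words\<close>

lemma pos_in_gwords [simp]: "pos f \<in> gwords I \<longleftrightarrow> f \<in> lists I"
  by (auto simp: gwords_def in_lists_conv_set)

lemma cox_word_eq_class:
  "f \<in> lists I \<Longrightarrow> cw f = pres_rel I (coxeter_relators I m) `` {pos f}"
proof (induction f)
  case Nil
  then show ?case
    by (simp add: cox_word_def coxeter_group_def presented_group_def)
next
  case (Cons i f)
  have "cw (i # f) = cox_gen I m i \<otimes>\<^bsub>coxeter_group I m\<^esub> cw f"
    by (simp add: cox_word_def)
  also have "\<dots> = pres_rel I (coxeter_relators I m) `` {[(i, True)] @ pos f}"
  proof -
    have "cw f = pres_rel I (coxeter_relators I m) `` {pos f}" using Cons by simp
    then show ?thesis unfolding cox_gen_def coxeter_group_def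
      by (simp only:, subst pres_mult_class) (use Cons.prems in \<open>auto simp: gwords_def\<close>)
  qed
  finally show ?case by simp
qed

lemma cox_word_eq_iff:
  "f \<in> lists I \<Longrightarrow> g \<in> lists I \<Longrightarrow> cw f = cw g \<longleftrightarrow> weq (pos f) (pos g)"
  using eq_equiv_class_iff[OF equiv_pres_rel, of "pos f" I "pos g" "coxeter_relators I m"]
  by (simp only: cox_word_eq_class pos_in_gwords) (simp add: pres_rel_def)

lemma weq_square: "i \<in> I \<Longrightarrow> weq [(i, True), (i, True)] []"
proof -
  assume i: "i \<in> I"
  have "m i i = enat 1" using cm i by (simp add: coxeter_matrix_def one_enat_def)
  then have "[(i, True), (i, True)] \<in> coxeter_relators I m"
    unfolding coxeter_relators_def using i by (auto intro!: exI[of _ i] exI[of _ "1::nat"])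
  from pres_eq.relator[OF Nil_in_gwords Nil_in_gwords this] i
  show ?thesis by (simp add: gwords_def)
qed

lemma weq_positive: "u \<in> gwords I \<Longrightarrow> weq u (pos (map fst u))"
proof (induction u)
  case Nil
  then show ?case by (simp add: pres_eq.refl)
next
  case (Cons a u)
  obtain i e where a: "a = (i, e)" by (cases a)
  have i: "i \<in> I" and u: "u \<in> gwords I" using Cons.prems by (auto simp: gwords_def a)
  have iT: "[(i, e)] \<in> gwords I" for e using i by (simp add: gwords_def)
  have "weq [(i, e)] [(i, True)]"
  proof (cases e)
    case True
    then show ?thesis using iT by (simp add: pres_eq.refl)
  next
    case False
    \<comment> \<open>The three letters collapse in two ways: by free cancellation to
      \<open>(i, True)\<close>, by \<open>weq_square\<close> to \<open>(i, False)\<close>.\<close>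
    have drop_pair: "weq [(i, False), (i, True), (i, True)] [(i, True)]"
      using pres_eq.cancel[OF Nil_in_gwords iT[of True] i, of _ False] by simp
    have "weq [(i, False), (i, True), (i, True)] [(i, False)]"
      using pres_eq_context[OF weq_square[OF i] iT[of False] Nil_in_gwords] by simp
    from pres_eq.trans[OF pres_eq.sym[OF this] drop_pair]
    show ?thesis using False by simp
  qed
  from pres_eq_append[OF this Cons.IH[OF u]] show ?case by (simp add: a)
qed

lemma cox_word_surj:
  assumes "w \<in> carrier (coxeter_group I m)"
  obtains f where "f \<in> lists I" "cw f = w"
proof -
  obtain u where u: "u \<in> gwords I" "w = pres_rel I (coxeter_relators I m) `` {u}"
    using assms by (auto simp: coxeter_group_def presented_group_def quotient_def)
  have f: "map fst u \<in> lists I" using u(1) by (auto simp: gwords_def in_lists_conv_set)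
  have "(u, pos (map fst u)) \<in> pres_rel I (coxeter_relators I m)"
    using weq_positive[OF u(1)] by (simp add: pres_rel_def)
  then have "w = cw (map fst u)"
    using cox_word_eq_class[OF f] u(2) equiv_class_eq[OF equiv_pres_rel] by metis
  then show thesis using that f by simp
qed

lemma cox_word_append_cong:
  assumes "f \<in> lists I" "f' \<in> lists I" "g \<in> lists I" "g' \<in> lists I" "cw f = cw f'" "cw g = cw g'"
  shows "cw (f @ g) = cw (f' @ g')"
  using assms pres_eq_append[of I "coxeter_relators I m" "pos f" "pos f'" "pos g" "pos g'"]
  by (simp add: cox_word_eq_iff)

lemma cox_word_Cons_cong:
  "i \<in> I \<Longrightarrow> f \<in> lists I \<Longrightarrow> g \<in> lists I \<Longrightarrow> cw f = cw g \<Longrightarrow> cw (i # f) = cw (i # g)"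
  using cox_word_append_cong[of "[i]" "[i]" f g] by simp

lemma cox_word_square: "i \<in> I \<Longrightarrow> cw [i, i] = cw []"
  by (simp add: cox_word_eq_iff weq_square)

lemma cox_word_cancel_Cons: "i \<in> I \<Longrightarrow> f \<in> lists I \<Longrightarrow> cw (i # i # f) = cw f"
  using cox_word_append_cong[of "[i, i]" "[]" f f] by (simp add: cox_word_square)

lemma cox_word_cancel_snoc: "i \<in> I \<Longrightarrow> f \<in> lists I \<Longrightarrow> cw (f @ [i, i]) = cw f"
  using cox_word_append_cong[of f f "[i, i]" "[]"] by (simp add: cox_word_square)

text \<open>Every Coxeter relator is a power of a two-letter word, so parity of length is an
  invariant of the group element. This is the sign character in elementary form.\<close>

lemma cox_word_parity:
  assumes "f \<in> lists I" "g \<in> lists I" "cw f = cw g"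
  shows "even (length f) \<longleftrightarrow> even (length g)"
proof -
  have "even (length r)" if "r \<in> coxeter_relators I m" for r
    using that by (auto simp: coxeter_relators_def length_concat sum_list_replicate)
  with pres_eq_parity[of I "coxeter_relators I m" "pos f" "pos g"] assms
  show ?thesis by (simp add: cox_word_eq_iff)
qed

section \<open>Reduced words\<close>

lemma reduced_word_iff:
  "red f \<longleftrightarrow> f \<in> lists I \<and> (\<forall>g\<in>lists I. cw g = cw f \<longrightarrow> length f \<le> length g)"
proof -
  have "cox_length I m (cw f) = length f \<longleftrightarrow> (\<forall>g\<in>lists I. cw g = cw f \<longrightarrow> length f \<le> length g)"
    if f: "f \<in> lists I"
  proof
    assume "cox_length I m (cw f) = length f"
    then show "\<forall>g\<in>lists I. cw g = cw f \<longrightarrow> length f \<le> length g"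
      unfolding cox_length_def by (metis (mono_tags, lifting) Least_le)
  next
    assume "\<forall>g\<in>lists I. cw g = cw f \<longrightarrow> length f \<le> length g"
    then show "cox_length I m (cw f) = length f"
      unfolding cox_length_def using f by (intro Least_equality) auto
  qed
  then show ?thesis by (auto simp: reduced_word_def)
qed

lemma reduced_in_lists: "red f \<Longrightarrow> f \<in> lists I"
  by (simp add: reduced_word_iff)

lemma reduced_exists:
  assumes "f \<in> lists I"
  obtains g where "red g" "cw g = cw f" "length g \<le> length f"
proof -
  obtain g where "g \<in> lists I \<and> cw g = cw f"
    "\<And>h. h \<in> lists I \<and> cw h = cw f \<Longrightarrow> length g \<le> length h"
    using ex_has_least_nat[of "\<lambda>g. g \<in> lists I \<and> cw g = cw f" f length] assms by auto
  then show thesis using that[of g] assms by (auto simp: reduced_word_iff)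
qed

text \<open>Parity forbids a loss of exactly one letter. The gain of two leaves room to add a letter
  back without exceeding the old length minus one.\<close>

lemma reduced_shorter:
  assumes "f \<in> lists I" "\<not> red f"
  obtains g where "red g" "cw g = cw f" "length g + 2 \<le> length f"
proof -
  obtain g where g: "red g" "cw g = cw f" "length g \<le> length f"
    using reduced_exists assms(1) by blast
  have "length g \<noteq> length f" using g assms by (metis reduced_word_iff)
  moreover have "even (length g) \<longleftrightarrow> even (length f)"
    using cox_word_parity g(2) reduced_in_lists[OF g(1)] assms(1) by blast
  ultimately have "length g + 2 \<le> length f" using g(3) by presburger
  then show thesis using that g by blast
qed

lemma reduced_transfer:
  "red f \<Longrightarrow> g \<in> lists I \<Longrightarrow> cw g = cw f \<Longrightarrow> length g \<le> length f \<Longrightarrow> red g"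
  unfolding reduced_word_iff by (metis order_trans)

text \<open>Replacing one factor by a shorter word for the same element would shorten the whole
  word.\<close>

lemma reduced_appendD:
  assumes "red (f @ g)"
  shows "red f" and "red g"
proof -
  have l: "f \<in> lists I" "g \<in> lists I" using reduced_in_lists[OF assms] by auto
  obtain f' where f': "red f'" "cw f' = cw f" "length f' \<le> length f"
    using reduced_exists l(1) by blast
  obtain g' where g': "red g'" "cw g' = cw g" "length g' \<le> length g"
    using reduced_exists l(2) by blast
  have l': "f' \<in> lists I" "g' \<in> lists I" using f' g' reduced_in_lists by auto
  have "cw (f' @ g') = cw (f @ g)" using cox_word_append_cong l l' f'(2) g'(2) by blast
  then have "length (f @ g) \<le> length (f' @ g')"
    using assms l' unfolding reduced_word_iff by (meson append_in_lists_conv)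
  then have "length f \<le> length f'" "length g \<le> length g'" using f'(3) g'(3) by auto
  then show "red f" "red g"
    using reduced_transfer[OF f'(1) l(1) f'(2)[symmetric]] reduced_transfer[OF g'(1) l(2) g'(2)[symmetric]]
    by blast+
qed

lemma reduced_Nil: "red []"
  by (simp add: reduced_word_iff)

text \<open>A single letter cannot lose two letters, so \<open>reduced_shorter\<close> rules out the
  contrary.\<close>

lemma reduced_single: "i \<in> I \<Longrightarrow> red [i]"
  by (rule ccontr) (rule reduced_shorter[of "[i]"], auto)

lemma alt_word_relation:
  assumes "i \<in> I" "j \<in> I" "m i j = enat n"
  shows "cw (alt_word i j (2 * n)) = cw []"
proof -
  have eq: "pos (alt_word i j (2 * n)) = concat (replicate n [(i, True), (j, True)])"
    by (simp add: alt_word_double map_concat)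
  have l: "alt_word i j (2 * n) \<in> lists I" by (rule alt_word_in_lists[OF assms(1,2)])
  have "pos (alt_word i j (2 * n)) \<in> coxeter_relators I m"
    unfolding eq using assms by (auto simp: coxeter_relators_def)
  from pres_eq.relator[OF Nil_in_gwords Nil_in_gwords this] l
  show ?thesis by (simp add: cox_word_eq_iff)
qed

end

section \<open>Galleries\<close>

lemma joined_Nil [simp]: "joined C adj [] c d \<longleftrightarrow> c \<in> C \<and> c = d"
  unfolding joined_def gallery_def by (auto simp: length_Suc_conv intro!: exI[of _ "[d]"])

lemma gallery_Cons:
  "gallery C adj (i # f) cs \<longleftrightarrow>
    (\<exists>c cs'. cs = c # cs' \<and> c \<in> C \<and> gallery C adj f cs' \<and> (c, hd cs') \<in> adj i \<and> c \<noteq> hd cs')"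
proof (cases cs)
  case (Cons c cs')
  then show ?thesis
    by (cases cs') (auto simp: gallery_def less_Suc_eq_0_disj nth_Cons')
qed (simp add: gallery_def)

text \<open>Recursion on the type replaces the indexed definition of galleries in all that
  follows.\<close>

lemma joined_Cons:
  "joined C adj (i # f) c d \<longleftrightarrow>
    c \<in> C \<and> (\<exists>e. (c, e) \<in> adj i \<and> c \<noteq> e \<and> joined C adj f e d)"
proof -
  have ne: "cs \<noteq> []" if "gallery C adj f cs" for f cs
    using that by (auto simp: gallery_def)
  show ?thesis
    unfolding joined_def gallery_Cons by (force dest: ne)
qed

lemma joined_in: "joined C adj f c d \<Longrightarrow> c \<in> C \<and> d \<in> C"
  by (induction f arbitrary: c) (auto simp: joined_Cons)

lemma joined_append:
  "joined C adj (f @ g) c d \<longleftrightarrow> (\<exists>e. joined C adj f c e \<and> joined C adj g e d)"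
proof (induction f arbitrary: c)
  case Nil
  then show ?case using joined_in[of C adj g c d] by auto
next
  case (Cons i f)
  then show ?case by (auto simp: joined_Cons)
qed

section \<open>Thick buildings\<close>

locale thick_building = coxeter_data I m
  for I :: "'i set" and m :: "'i \<Rightarrow> 'i \<Rightarrow> enat" +
  fixes C :: "'c set" and adj :: "'i \<Rightarrow> 'c rel" and \<delta> :: "'c \<Rightarrow> 'c \<Rightarrow> 'i gword set"
  assumes cs: "chamber_system I C adj"
    and wd: "weyl_distance I m C adj \<delta>"
    and th: "thick I C adj"
begin

abbreviation "jn \<equiv> joined C adj"

section \<open>Panels and galleries of reduced type\<close>

lemma adj_equiv: "i \<in> I \<Longrightarrow> equiv C (adj i)"
  using cs by (simp add: chamber_system_def)

lemma adj_in: "i \<in> I \<Longrightarrow> (a, b) \<in> adj i \<Longrightarrow> a \<in> C \<and> b \<in> C"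
  using equiv_type[OF adj_equiv] by blast

lemma adj_refl: "i \<in> I \<Longrightarrow> a \<in> C \<Longrightarrow> (a, a) \<in> adj i"
  using adj_equiv by (meson equivE refl_onD)

lemma adj_sym: "i \<in> I \<Longrightarrow> (a, b) \<in> adj i \<Longrightarrow> (b, a) \<in> adj i"
  using adj_equiv by (meson equivE symE)

lemma adj_trans: "i \<in> I \<Longrightarrow> (a, b) \<in> adj i \<Longrightarrow> (b, c) \<in> adj i \<Longrightarrow> (a, c) \<in> adj i"
  using adj_equiv by (meson equivE transE)

lemma joined_single: "i \<in> I \<Longrightarrow> jn [i] a b \<longleftrightarrow> (a, b) \<in> adj i \<and> a \<noteq> b"
  using adj_in by (auto simp: joined_Cons)

lemma joined_ConsI: "i \<in> I \<Longrightarrow> (a, b) \<in> adj i \<Longrightarrow> a \<noteq> b \<Longrightarrow> jn f b c \<Longrightarrow> jn (i # f) a c"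
  using adj_in by (auto simp: joined_Cons)

lemma joined_snocI: "i \<in> I \<Longrightarrow> jn f a b \<Longrightarrow> (b, c) \<in> adj i \<Longrightarrow> b \<noteq> c \<Longrightarrow> jn (f @ [i]) a c"
  using joined_single joined_append by metis

lemma delta_iff: "red f \<Longrightarrow> a \<in> C \<Longrightarrow> b \<in> C \<Longrightarrow> \<delta> a b = cw f \<longleftrightarrow> jn f a b"
  using wd by (simp add: weyl_distance_def)

lemma delta_joined: "red f \<Longrightarrow> jn f a b \<Longrightarrow> \<delta> a b = cw f"
  using delta_iff joined_in by metis

text \<open>Both types express the same value of \<open>\<delta>\<close>. This rewriting of
  galleries is how the building axiom enters most arguments below.\<close>

lemma joined_transfer: "red f \<Longrightarrow> red g \<Longrightarrow> cw f = cw g \<Longrightarrow> jn f a b \<Longrightarrow> jn g a b"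
  using delta_iff joined_in by metis

lemma third_chamber:
  assumes "i \<in> I" "(a, b) \<in> adj i"
  obtains c where "(a, c) \<in> adj i" "(b, c) \<in> adj i" "c \<noteq> a" "c \<noteq> b"
proof -
  have "a \<in> C" using assms adj_in by blast
  then obtain d d' where "d \<noteq> d'" "d \<noteq> a" "d' \<noteq> a" "(d, a) \<in> adj i" "(d', a) \<in> adj i"
    using th assms(1) unfolding thick_def by meson
  \<comment> \<open>At most one of \<open>d\<close> and \<open>d'\<close> is \<open>b\<close>; the
    other serves as \<open>c\<close>.\<close>
  then show thesis using that assms adj_sym adj_trans by metis
qed

lemma joined_exists:
  "f \<in> lists I \<Longrightarrow> a \<in> C \<Longrightarrow> \<exists>b. jn f a b"
proof (induction f arbitrary: a)
  case (Cons i f)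
  then have "i \<in> I" "f \<in> lists I" by auto
  then obtain e where "(a, e) \<in> adj i" "e \<noteq> a"
    \<comment> \<open>Applied to the pair \<open>(a, a)\<close>, \<open>third_chamber\<close> yields
      a chamber of the panel other than \<open>a\<close>.\<close>
    using third_chamber adj_refl Cons.prems by metis
  then show ?case using Cons adj_in \<open>i \<in> I\<close> \<open>f \<in> lists I\<close> joined_ConsI by metis
qed auto

section \<open>A case of the exchange condition\<close>

text \<open>Counterpart of the rule BwBsB \<subseteq> BwB \<union> BwsB of Tits systems. If
  \<open>f @ [k]\<close> is not reduced, \<open>cw f\<close> has a reduced word ending in
  \<open>k\<close>, so a gallery from \<open>a\<close> to \<open>b\<close> enters the
  \<open>k\<close>-panel of \<open>b\<close> at some \<open>e\<close>; the two outcomes are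
  \<open>c = e\<close> and \<open>c \<noteq> e\<close>.\<close>

lemma delta_step:
  assumes f: "red f" and k: "k \<in> I" and fa: "jn f a b" and bc: "(b, c) \<in> adj k" "b \<noteq> c"
  shows "\<delta> a c = cw f \<or> \<delta> a c = cw (f @ [k])"
proof (cases "red (f @ [k])")
  case True
  then show ?thesis using joined_snocI[OF k fa bc] delta_joined by blast
next
  case False
  have fl: "f \<in> lists I" using f reduced_in_lists by blast
  then obtain g where g: "red g" "cw g = cw (f @ [k])" "length g + 2 \<le> length (f @ [k])"
    using reduced_shorter[of "f @ [k]"] False k by auto
  have gl: "g \<in> lists I" using g reduced_in_lists by blast
  have "cw (g @ [k]) = cw ((f @ [k]) @ [k])"
    by (rule cox_word_append_cong) (use gl fl k g in auto)
  then have gk: "cw (g @ [k]) = cw f" using cox_word_cancel_snoc[OF k fl] by simp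
  \<comment> \<open>\<open>g\<close> has at most \<open>length f - 1\<close> letters, so
    \<open>g @ [k]\<close> is no longer than \<open>f\<close>.\<close>
  have rgk: "red (g @ [k])"
    by (rule reduced_transfer[OF f]) (use gl k gk g(3) in auto)
  have "jn (g @ [k]) a b" using joined_transfer[OF f rgk gk[symmetric] fa] .
  then obtain e where e: "jn g a e" "(e, b) \<in> adj k"
    by (auto simp: joined_append joined_single[OF k])
  show ?thesis
  proof (cases "e = c")
    case True
    then show ?thesis using delta_joined[OF g(1)] e(1) g(2) by simp
  next
    case False
    then have "jn (g @ [k]) a c" using joined_snocI[OF k e(1)] adj_trans[OF k e(2) bc(1)] by blast
    then show ?thesis using delta_joined[OF rgk] gk by simp
  qed
qed

text \<open>The distance from a suitable \<open>a\<close> to \<open>d\<close> is computed twice: as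
  \<open>f @ [k]\<close> through \<open>b\<close>, and by \<open>delta_step\<close> from the gallery
  of type \<open>i # f\<close> through \<open>c0\<close> and \<open>c\<close>. The second gives
  \<open>i # f\<close> or \<open>i # f @ [k]\<close>, and parity excludes the latter.\<close>

lemma folding:
  assumes "c0 \<in> C" and i: "i \<in> I" and k: "k \<in> I"
    and fi: "red (i # f)" and fk: "red (f @ [k])" and nr: "\<not> red (i # f @ [k])"
  shows "cw (i # f) = cw (f @ [k])"
proof -
  have fl: "f \<in> lists I" using fi reduced_in_lists by fastforce
  have fr: "red f" using reduced_appendD(1)[OF fk] .
  obtain c where c: "jn f c0 c" using joined_exists[OF fl assms(1)] by blast
  obtain d where d: "jn [k] c d" using joined_exists[of "[k]" c] joined_in[OF c] k by auto
  then have cd: "(c, d) \<in> adj k" "c \<noteq> d" using joined_single[OF k] by auto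
  have bd: "jn (f @ [k]) c0 d" using c d joined_append by metis
  obtain g where g: "red g" "cw g = cw (i # f @ [k])" "length g + 2 \<le> length (i # f @ [k])"
    using reduced_shorter[of "i # f @ [k]"] nr fl i k by auto
  have gl: "g \<in> lists I" using g reduced_in_lists by blast
  have "cw (i # g) = cw (i # i # f @ [k])"
    by (rule cox_word_Cons_cong) (use gl fl i k g in auto)
  then have ig: "cw (i # g) = cw (f @ [k])" using cox_word_cancel_Cons[of i "f @ [k]"] i k fl by simp
  \<comment> \<open>\<open>g\<close> is no longer than \<open>f\<close>, so \<open>i # g\<close> is
    another reduced word for the element of \<open>f @ [k]\<close>.\<close>
  have rig: "red (i # g)"
    by (rule reduced_transfer[OF fk]) (use gl i ig g(3) in auto)
  have "jn (i # g) c0 d" using joined_transfer[OF fk rig ig[symmetric] bd] .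
  then obtain b where b: "(c0, b) \<in> adj i" "jn g b d" by (auto simp: joined_Cons)
  \<comment> \<open>Thickness enters here: \<open>a\<close> must differ from \<open>c0\<close> and
    from \<open>b\<close>, so that both galleries can be started at \<open>a\<close> with a genuine
    step of type \<open>i\<close>.\<close>
  obtain a where a: "(c0, a) \<in> adj i" "(b, a) \<in> adj i" "a \<noteq> c0" "a \<noteq> b"
    using third_chamber[OF i b(1)] by blast
  have "jn (i # g) a d" using joined_ConsI[OF i adj_sym[OF i a(2)] a(4) b(2)] .
  then have ad: "\<delta> a d = cw (f @ [k])" using delta_joined[OF rig] ig by simp
  have "jn (i # f) a c" using joined_ConsI[OF i adj_sym[OF i a(1)] a(3) c] .
  from delta_step[OF fi k this cd] ad
  have "cw (f @ [k]) = cw (i # f) \<or> cw (f @ [k]) = cw (i # f @ [k])" by simp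
  moreover have "cw (f @ [k]) \<noteq> cw (i # f @ [k])"
    using cox_word_parity[of "f @ [k]" "i # f @ [k]"] fl i k by auto
  ultimately show ?thesis by simp
qed

text \<open>The alternating words of length 0 are reduced and one of length \<open>2 * r\<close> is
  trivial, so reducedness of both breaks down between some \<open>N\<close> and
  \<open>Suc N\<close>. There \<open>folding\<close> identifies the two words of length
  \<open>N\<close>; no relation between \<open>N\<close> and \<open>m i j\<close> is
  claimed.\<close>

lemma braid_relation:
  assumes "c0 \<in> C" and i: "i \<in> I" and j: "j \<in> I" and "i \<noteq> j" and "m i j < \<infinity>"
  obtains n where "red (alt_word i j (Suc n))" "red (alt_word j i (Suc n))"
    "cw (alt_word i j (Suc n)) = cw (alt_word j i (Suc n))"
proof -
  define P where "P n \<longleftrightarrow> red (alt_word i j n) \<and> red (alt_word j i n)" for n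
  obtain r where r: "m i j = enat r" using assms(5) by auto
  have "2 \<le> m i j" using cm i j \<open>i \<noteq> j\<close> by (auto simp: coxeter_matrix_def)
  then have r2: "2 \<le> r" using r by (simp add: numeral_eq_enat)
  have "\<not> red (alt_word i j (2 * r))"
    using alt_word_relation[OF i j r] r2 reduced_word_iff[of "alt_word i j (2 * r)"]
    by force
  then have "\<not> P (2 * r)" by (simp add: P_def)
  moreover have "P 0" by (simp add: P_def reduced_Nil)
  ultimately obtain N where N: "P N" "\<not> P (Suc N)"
    using nat_induct[of P "2 * r"] by blast
  \<comment> \<open>This rules out \<open>N = 0\<close>, so that the words have a first letter to
    strip.\<close>
  have "P 1" by (simp add: P_def reduced_single i j)
  then obtain n where n: "N = Suc n" using N by (cases N) auto
  \<comment> \<open>With \<open>f = alt_word y x n\<close> and its next letter \<open>k\<close>, the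
    words \<open>x # f\<close>, \<open>f @ [k]\<close> and \<open>x # f @ [k]\<close> are all
    alternating.\<close>
  have fold: "cw (alt_word x y (Suc n)) = cw (alt_word y x (Suc n))"
    if "x \<in> I" "y \<in> I" "red (alt_word x y (Suc n))" "red (alt_word y x (Suc n))"
      "\<not> red (alt_word x y (Suc (Suc n)))" for x y
    using folding[of c0 x "if even n then y else x" "alt_word y x n"] that \<open>c0 \<in> C\<close>
    by (simp flip: alt_word_snoc)
  show thesis
    using that[of n] N fold[of i j] fold[of j i] i j unfolding P_def n by metis
qed

section \<open>Bijections between panels\<close>

text \<open>The bijection sends \<open>x'\<close> to the unique chamber of the
  \<open>k\<close>-panel of \<open>y\<close> at distance \<open>cw f\<close> from it. A second such
  chamber would also be at distance \<open>cw (f @ [k])\<close>, which has the other parity.\<close>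

lemma panel_bij:
  assumes i: "i \<in> I" and k: "k \<in> I" and rif: "red (i # f)" and rfk: "red (f @ [k])"
    and eq: "cw (i # f) = cw (f @ [k])" and xy: "jn f x y"
  shows "adj i `` {x} \<approx> adj k `` {y}"
proof -
  have fr: "red f" using reduced_appendD(1)[OF rfk] .
  have fl: "f \<in> lists I" using reduced_in_lists[OF fr] .
  have ne: "cw f \<noteq> cw (f @ [k])" using cox_word_parity[of f "f @ [k]"] fl k by auto
  have ur: "y' = y''" if "jn f x' y'" "jn f x' y''" "(y', y'') \<in> adj k" for x' y' y''
    using joined_snocI[OF k that(1,3)] delta_joined[OF fr that(2)] delta_joined[OF rfk] ne by metis
  have ul: "x' = x''" if "jn f x' y'" "jn f x'' y'" "(x', x'') \<in> adj i" for x' x'' y'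
    using joined_ConsI[OF i that(3) _ that(2)] delta_joined[OF fr that(1)] delta_joined[OF rif] ne eq
    by metis
  \<comment> \<open>A chamber \<open>x' \<noteq> x\<close> reaches \<open>y\<close> by type
    \<open>i # f\<close>; rewritten as \<open>f @ [k]\<close>, this gallery has its last but one
    chamber in the \<open>k\<close>-panel of \<open>y\<close>.\<close>
  have er: "\<exists>y'. (y, y') \<in> adj k \<and> jn f x' y'" if x': "(x, x') \<in> adj i" for x'
  proof (cases "x' = x")
    case True
    then show ?thesis using xy joined_in adj_refl k by metis
  next
    case False
    then have "jn (f @ [k]) x' y"
      using joined_transfer[OF rif rfk eq] joined_ConsI[OF i adj_sym[OF i x']] xy by blast
    then show ?thesis using joined_append joined_single[OF k] adj_sym[OF k] by metis
  qed
  have el: "\<exists>x'. (x, x') \<in> adj i \<and> jn f x' y'" if y': "(y, y') \<in> adj k" for y'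
  proof (cases "y' = y")
    case True
    then show ?thesis using xy joined_in adj_refl i by metis
  next
    case False
    then have "jn (i # f) x y'"
      using joined_transfer[OF rfk rif eq[symmetric]] joined_snocI[OF k xy y'] by blast
    then show ?thesis by (auto simp: joined_Cons)
  qed
  obtain h where h: "\<And>x'. (x, x') \<in> adj i \<Longrightarrow> (y, h x') \<in> adj k \<and> jn f x' (h x')"
    using er by metis
  have "bij_betw h (adj i `` {x}) (adj k `` {y})"
  proof (rule bij_betw_imageI)
    show "inj_on h (adj i `` {x})"
      using h ul adj_sym[OF i] adj_trans[OF i] by (intro inj_onI) (metis Image_singleton_iff)
    show "h ` (adj i `` {x}) = adj k `` {y}"
    proof (intro equalityI subsetI)
      fix y' assume "y' \<in> adj k `` {y}"
      then have y': "(y, y') \<in> adj k" by simp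
      then obtain x' where x': "(x, x') \<in> adj i" "jn f x' y'" using el by blast
      then have "h x' = y'" using ur h y' adj_sym[OF k] adj_trans[OF k] by metis
      then show "y' \<in> h ` (adj i `` {x})" using x' by blast
    qed (use h in blast)
  qed
  then show ?thesis by (auto simp: eqpoll_def)
qed

lemma panel_eqpoll_adjacent:
  assumes i: "i \<in> I" and j: "j \<in> I" and fin: "m i j < \<infinity>"
    and ab: "(a, b) \<in> adj i" "a \<noteq> b"
  shows "adj j `` {a} \<approx> adj j `` {b}"
proof -
  have C: "a \<in> C" "b \<in> C" using ab adj_in i by blast+
  have same: "adj j `` {a} \<approx> adj j `` {b}" if "(a, b) \<in> adj j"
    using equiv_class_eq[OF adj_equiv[OF j] that] by simp
  show ?thesis
  proof (cases "i = j")
    case True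
    then show ?thesis using ab same by simp
  next
    case False
    obtain n where n: "red (alt_word i j (Suc n))" "red (alt_word j i (Suc n))"
      "cw (alt_word i j (Suc n)) = cw (alt_word j i (Suc n))"
      using braid_relation[OF C(1) i j False fin] by blast
    show ?thesis
    proof (cases n)
      \<comment> \<open>Here the generators of \<open>i\<close> and \<open>j\<close> coincide, which
        has not been excluded; then \<open>a\<close> and \<open>b\<close> are also
        \<open>j\<close>-adjacent and share their \<open>j\<close>-panel.\<close>
      case 0
      then have "cw [i] = cw [j]" using n by simp
      then have "jn [j] a b"
        using joined_transfer[OF reduced_single[OF i] reduced_single[OF j]] ab
          joined_single[OF i] by blast
      then show ?thesis using joined_single[OF j] same by blast
    next
      case (Suc r)
      \<comment> \<open>The last letter of \<open>alt_word i j (Suc n)\<close>, so that the braid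
        relation reads \<open>cw (f @ [k]) = cw (j # f)\<close>.\<close>
      define k where "k = (if even n then i else j)"
      have k: "k \<in> I" using i j by (simp add: k_def)
      define f where "f = alt_word i j n"
      have f: "f = i # alt_word j i r" by (simp add: f_def Suc)
      have fk: "alt_word i j (Suc n) = f @ [k]" unfolding f_def k_def by (rule alt_word_snoc)
      have jf: "alt_word j i (Suc n) = j # f" by (simp add: f_def)
      obtain c where c: "(a, c) \<in> adj i" "(b, c) \<in> adj i" "c \<noteq> a" "c \<noteq> b"
        using third_chamber[OF i ab(1)] by blast
      \<comment> \<open>The type is \<open>f\<close> without its first letter \<open>i\<close>. As
        \<open>c\<close> differs from \<open>a\<close> and \<open>b\<close>, a first step to
        \<open>c\<close> gives type \<open>f\<close> from both, and one \<open>k\<close>-panel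
        serves for the two bijections.\<close>
      obtain y where "jn (alt_word j i r) c y"
        using joined_exists[OF alt_word_in_lists[OF j i]] adj_in[OF i c(1)] by blast
      then have "jn f a y" "jn f b y"
        unfolding f using joined_ConsI[OF i] c by metis+
      then have "adj j `` {a} \<approx> adj k `` {y}" "adj j `` {b} \<approx> adj k `` {y}"
        using panel_bij[OF j k n(2)[unfolded jf] n(1)[unfolded fk] n(3)[unfolded fk jf, symmetric]]
        by blast+
      then show ?thesis using eqpoll_sym eqpoll_trans by blast
    qed
  qed
qed

text \<open>A reduced word for \<open>\<delta> a b\<close> gives a gallery from \<open>a\<close> to
  \<open>b\<close>, along which the size of the \<open>j\<close>-panel is carried step by
  step.\<close>

lemma panel_eqpoll:
  assumes fin: "\<forall>i\<in>I. \<forall>j\<in>I. m i j < \<infinity>" and "a \<in> C" "b \<in> C" and j: "j \<in> I"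
  shows "adj j `` {a} \<approx> adj j `` {b}"
proof -
  have "\<delta> a b \<in> carrier (coxeter_group I m)" using wd assms by (simp add: weyl_distance_def)
  then obtain f where "f \<in> lists I" "\<delta> a b = cw f" using cox_word_surj by metis
  then obtain g where g: "red g" "\<delta> a b = cw g" using reduced_exists by metis
  then have "g \<in> lists I" "jn g a b"
    using delta_iff[OF g(1)] assms(2,3) reduced_in_lists by auto
  \<comment> \<open>Reducedness has served its purpose: the induction keeps only the gallery and its
    letters.\<close>
  then show ?thesis
  proof (induction g arbitrary: a)
    case Nil
    then show ?case by simp
  next
    case (Cons i g)
    then have i: "i \<in> I" by auto
    obtain e where e: "(a, e) \<in> adj i" "a \<noteq> e" "jn g e b"
      using Cons.prems by (auto simp: joined_Cons)
    have "adj j `` {a} \<approx> adj j `` {e}" using panel_eqpoll_adjacent[OF i j _ e(1,2)] fin i j by blast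
    moreover have "adj j `` {e} \<approx> adj j `` {b}"
      using Cons e(3) by auto
    ultimately show ?case by (rule eqpoll_trans)
  qed
qed

text \<open>The word \<open>[j]\<close> is reduced, so distance \<open>cox_gen I m j\<close> means
  one step of type \<open>j\<close>: the sphere is a panel without its centre.\<close>

lemma sphere_gen:
  assumes "j \<in> I" "a \<in> C"
  shows "sphere C \<delta> (cox_gen I m j) a = adj j `` {a} - {a}"
proof -
  have "cox_gen I m j = cw [j]"
    using cox_word_eq_class[of "[j]"] assms(1) by (simp add: cox_gen_def)
  then have "b \<in> sphere C \<delta> (cox_gen I m j) a \<longleftrightarrow> b \<in> adj j `` {a} - {a}" for b
    using delta_iff[OF reduced_single[OF assms(1)] assms(2), of b] joined_single[OF assms(1), of a b]
      adj_in[OF assms(1), of a b]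
    unfolding sphere_def mem_Collect_eq by (simp only:) blast
  then show ?thesis by blast
qed

end

theorem theorem2p4:
  fixes I :: "'i set" and m :: "'i \<Rightarrow> 'i \<Rightarrow> enat"
    and C :: "'c set" and adj :: "'i \<Rightarrow> 'c rel" and \<delta> :: "'c \<Rightarrow> 'c \<Rightarrow> 'i gword set"
  assumes "building I m C adj"
    and "weyl_distance I m C adj \<delta>"
    and "locally_finite I C adj"
    and "thick I C adj"
    and "\<forall>i\<in>I. \<forall>j\<in>I. m i j < \<infinity>"
  shows "regular_building I m C \<delta>"
proof -
  interpret thick_building I m C adj \<delta>
    using assms by unfold_locales (auto simp: building_def)
  have "sphere C \<delta> (cox_gen I m j) a \<approx> sphere C \<delta> (cox_gen I m j) b"
    if j: "j \<in> I" and a: "a \<in> C" and b: "b \<in> C" for j a b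
  proof -
    have fin: "finite (adj j `` {c})" if "c \<in> C" for c
      using assms(3) j that by (simp add: locally_finite_def Image_singleton)
    \<comment> \<open>Local finiteness turns equipotence into equality of \<open>card\<close>, from
      which the centre is subtracted on both sides.\<close>
    have "card (adj j `` {a}) = card (adj j `` {b})"
      using panel_eqpoll[OF assms(5) a b j] eqpoll_iff_card[OF fin[OF a] fin[OF b]] by blast
    then show ?thesis
      using fin[OF a] fin[OF b] adj_refl[OF j] a b by (simp add: sphere_gen j eqpoll_iff_card)
  qed
  then show ?thesis by (auto simp: regular_building_def cox_gens_def)
qed

end
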